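(* Let $S$ and $X$ be nonnegative integers. The number of unordered pairs $\{a,b\}$ of positive integers with $a+b=S$ and $a\oplus b = X$ equals $f(S,X)$, where $$f(S,X)=\begin{cases} 0 & \text{if } S-X \text{ is odd},\\ 0 & \text{if } S-X \text{ is even and for some } i \text{ the } i\text{th binary digit of } \tfrac{S-X}{2} \text{ and of } X \text{ both equal } 1,\\ 2^{g(X)-1}-1 & \text{otherwise, if } S=X,\\ 2^{g(X)-1} & \text{otherwise (} S-X \text{ even).}\end{cases}$$ (The cases are checked in the order listed.)
   Context: $\oplus$ denotes bitwise exclusive-or of nonnegative integers. For a nonnegative integer $n$, $g(n)$ denotes the number of $1$s in the binary expansion of $n$ (so $g(0)=0$, $g(1)=1$, and $g(n)=(n \bmod 2)+g(\lfloor n/2\rfloor)$). Binary digits of a negative integer are taken in two's complement.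
   Formalization: At X = 0 the exponent g(X)−1 = −1 would give 1/2 or −1/2, which is not a count (for S = 2, X = 0 the only pair is {1,1}); there the exponent is read as 0. Pairs with a = b are allowed. For X ≥ 1 the formula is unchanged. *)

theory Defs
  imports Main
begin

definition popcount :: "nat \<Rightarrow> nat" where
  "popcount n = card {i. bit n i}"

lemma popcount_0: "popcount 0 = 0"
  by (simp add: popcount_def)

lemma finite_bits_nat: "finite {i. bit (n::nat) i}"
proof (rule finite_subset)
  show "{i. bit n i} \<subseteq> {..<n}"
  proof
    fix i assume "i \<in> {i. bit n i}"
    then have "\<not> n < 2 ^ i" by (auto simp: bit_iff_odd)
    moreover have "i < 2 ^ i" by simp
    ultimately have "i < n" by linarith
    then show "i \<in> {..<n}" by simp
  qed
qed simp

lemma popcount_rec: "popcount n = n mod 2 + popcount (n div 2)"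
proof -
  have eq: "{i. bit n i} = (if odd n then {0} else {}) \<union> Suc ` {i. bit (n div 2) i}"
  proof (rule set_eqI)
    fix i
    show "i \<in> {i. bit n i} \<longleftrightarrow>
      i \<in> (if odd n then {0} else {}) \<union> Suc ` {i. bit (n div 2) i}"
      by (cases i) (auto simp: bit_0 bit_Suc)
  qed
  have "card (Suc ` {i. bit (n div 2) i}) = popcount (n div 2)"
    by (simp add: popcount_def card_image)
  then show ?thesis
    unfolding popcount_def [of n] eq
    by (auto simp: card_insert_if finite_bits_nat odd_iff_mod_2_eq_one)
qed

text \<open>
  \<open>bit\<close> on \<^typ>\<open>int\<close> is two's complement, so the second case is meaningful also for \<open>S < X\<close>.

  The exponent \<open>popcount X - 1\<close> is a subtraction on \<^typ>\<open>nat\<close>. It differs from the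
  integer difference
  only at \<open>X = 0\<close>, where \<open>2\<close> to the power \<open>-1\<close> could not be a count; there the
  exponent is read as \<open>0\<close>. The outer subtraction of \<open>1\<close> is on \<^typ>\<open>int\<close>.
\<close>

definition pair_formula :: "nat \<Rightarrow> nat \<Rightarrow> int" where
  "pair_formula S X =
    (if odd (int S - int X) then 0
     else if \<exists>i. bit ((int S - int X) div 2) i \<and> bit X i then 0
     else if S = X then 2 ^ (popcount X - 1) - 1
     else 2 ^ (popcount X - 1))"

text \<open>
  A set \<open>{a, b}\<close> of naturals represents an unordered pair with \<open>a = b\<close> allowed, as a singleton
  (this happens only for \<open>X = 0\<close>).
\<close>

definition xor_pairs :: "nat \<Rightarrow> nat \<Rightarrow> nat set set" where
  "xor_pairs S X = {{a, b} | a b. 0 < a \<and> 0 < b \<and> a + b = S \<and> xor a b = X}"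

end

theory Submission
  imports Defs
begin

text \<open>
  Separating carries from digit sums gives \<open>a + b = (a XOR b) + 2 (a AND b)\<close>. So \<open>a + b = S\<close> and
  \<open>a XOR b = X\<close> hold exactly if \<open>a XOR b = X\<close> and \<open>a AND b = D\<close> with \<open>S = X + 2 D\<close>. Such pairs
  exist only if \<open>D\<close> and \<open>X\<close> have no common bit, and then they arise by distributing the bits of
  \<open>X\<close> among \<open>a\<close> and \<open>b\<close>. Fixing one bit of \<open>X\<close> to belong to \<open>b\<close> selects one of the two orders of
  each unordered pair, leaving \<open>g(X) - 1\<close> free choices. A zero entry occurs only in \<open>{0, X}\<close>,
  when \<open>D = 0\<close>.
\<close>

lemma add_eq_xor_plus_double_and: "a + b = xor a b + 2 * and a b" for a b :: nat
proof (induction a arbitrary: b rule: less_induct)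
  case (less a)
  show ?case
  proof (cases "a = 0")
    case False
    then have "a div 2 + b div 2 = xor (a div 2) (b div 2) + 2 * and (a div 2) (b div 2)"
      by (intro less) simp
    then show ?thesis
      unfolding xor_nat_rec [of a b] and_nat_rec [of a b]
      by (cases "odd a"; cases "odd b") (auto elim!: evenE oddE)
  qed simp
qed

text \<open>Needed for surjectivity in \<open>card_submasks\<close>: each finite set of positions is
  reached by setting its bits one by one, starting from 0.\<close>

lemma ex_nat_with_bits:
  assumes "finite M"
  shows "\<exists>m :: nat. {i. bit m i} = M"
  using assms
proof induction
  case empty
  show ?case by (intro exI [of _ 0]) simp
next
  case (insert i M)
  then obtain m :: nat where "{i. bit m i} = M" by blast
  then have "{j. bit (set_bit i m) j} = insert i M"
    by (auto simp: bit_set_bit_iff)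
  then show ?case by blast
qed

text \<open>A number is determined by its set of 1-bits, so the submasks of \<open>n\<close>
  correspond to the subsets of its bit positions.\<close>

lemma card_submasks: "card {m :: nat. \<forall>i. bit m i \<longrightarrow> bit n i} = 2 ^ popcount n"
proof -
  have "bij_betw (\<lambda>m :: nat. {i. bit m i}) {m. \<forall>i. bit m i \<longrightarrow> bit n i} (Pow {i. bit n i})"
  proof (rule bij_betw_imageI)
    show "inj_on (\<lambda>m :: nat. {i. bit m i}) {m. \<forall>i. bit m i \<longrightarrow> bit n i}"
      by (auto intro!: inj_onI bit_eqI)
    show "(\<lambda>m :: nat. {i. bit m i}) ` {m. \<forall>i. bit m i \<longrightarrow> bit n i} = Pow {i. bit n i}"
    proof
      show "Pow {i. bit n i} \<subseteq> (\<lambda>m :: nat. {i. bit m i}) ` {m. \<forall>i. bit m i \<longrightarrow> bit n i}"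
      proof
        fix M assume M: "M \<in> Pow {i. bit n i}"
        then have "finite M" using finite_subset [OF _ finite_bits_nat] by blast
        then obtain m :: nat where "{i. bit m i} = M" using ex_nat_with_bits by blast
        with M show "M \<in> (\<lambda>m :: nat. {i. bit m i}) ` {m. \<forall>i. bit m i \<longrightarrow> bit n i}"
          by blast
      qed
    qed auto
  qed
  from bij_betw_same_card [OF this] show ?thesis
    by (simp add: card_Pow finite_bits_nat popcount_def)
qed

lemma popcount_unset_bit:
  assumes "bit n t"
  shows "popcount (unset_bit t n) = popcount n - 1"
proof -
  have "{i. bit (unset_bit t n) i} = {i. bit n i} - {t}"
    by (auto simp: bit_unset_bit_iff)
  then show ?thesis
    using assms by (simp add: popcount_def finite_bits_nat)
qed

lemma card_unordered_pairs_xor_and: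
  fixes X D :: nat
  assumes disj: "\<And>i. \<not> (bit D i \<and> bit X i)" and "X \<noteq> 0"
  shows "card {{a, b} | a b. xor a b = X \<and> and a b = D} = 2 ^ (popcount X - 1)"
    (is "card ?U = _")
proof -
  from \<open>X \<noteq> 0\<close> obtain t where t: "bit X t"
    by (metis bit_eqI bit_0_eq bot_apply bot_bool_def)
  \<comment> \<open>\<open>m\<close> collects the bits of \<open>X\<close> given to the first entry;
    the bits of \<open>D\<close> go to both. Bit \<open>t\<close> always goes to the second.\<close>
  let ?N = "{m :: nat. \<forall>i. bit m i \<longrightarrow> bit (unset_bit t X) i}"
  let ?l = "\<lambda>m. or D m" and ?r = "\<lambda>m. or D (xor X m)"
  have tD: "\<not> bit D t" using disj t by blast
  have N: "\<not> bit m t" "bit m i \<Longrightarrow> bit X i" if "m \<in> ?N" for m i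
    using that by (auto simp: bit_unset_bit_iff)
  have "inj_on (\<lambda>m. {?l m, ?r m}) ?N"
  proof (rule inj_onI)
    fix m m' assume m: "m \<in> ?N" and m': "m' \<in> ?N" and eq: "{?l m, ?r m} = {?l m', ?r m'}"
    \<comment> \<open>Bit \<open>t\<close> tells the entries apart, so equal doubletons cannot match
      crosswise.\<close>
    have "\<not> bit (?l m) t" "bit (?r m') t"
      using N(1) [OF m] N(1) [OF m'] t tD by (auto simp: bit_or_iff bit_xor_iff)
    with eq have *: "?l m = ?l m'" by (auto simp: doubleton_eq_iff)
    \<comment> \<open>Both masks lie within \<open>X\<close>, which is disjoint from
      \<open>D\<close>, so \<open>or D\<close> loses no information.\<close>
    show "m = m'"
    proof (rule bit_eqI)
      fix i
      have "bit (?l m) i = bit (?l m') i" using * by simp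
      then show "bit m i = bit m' i"
        using N(2) [OF m, of i] N(2) [OF m', of i] disj [of i] by (auto simp: bit_or_iff)
    qed
  qed
  moreover have "(\<lambda>m. {?l m, ?r m}) ` ?N = ?U"
  proof (intro equalityI subsetI)
    fix s assume "s \<in> (\<lambda>m. {?l m, ?r m}) ` ?N"
    then obtain m where m: "m \<in> ?N" and s: "s = {?l m, ?r m}" by blast
    have "xor (?l m) (?r m) = X" "and (?l m) (?r m) = D"
      by (rule bit_eqI; use disj N(2) [OF m] in \<open>auto simp: bit_simps\<close>)+
    with s show "s \<in> ?U" by blast
  next
    fix s assume "s \<in> ?U"
    then obtain a b where s: "s = {a, b}" and ab: "xor a b = X" "and a b = D" by blast
    \<comment> \<open>As \<open>t\<close> is a bit of \<open>X\<close>, exactly one entry contains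
      it; swap if that is \<open>a\<close>.\<close>
    have "\<exists>a b. s = {a, b} \<and> xor a b = X \<and> and a b = D \<and> \<not> bit a t"
    proof (cases "bit a t")
      case True
      then have "\<not> bit b t" using t ab by (auto simp: bit_xor_iff)
      with s ab show ?thesis
        by (metis insert_commute and.commute xor.commute)
    qed (use s ab in blast)
    then obtain a b where s: "s = {a, b}" and X: "xor a b = X" and D: "and a b = D"
      and a: "\<not> bit a t" by blast
    \<comment> \<open>The bits of \<open>a\<close> outside \<open>X\<close> are shared with
      \<open>b\<close>, hence are those of \<open>D\<close>; the mask is what remains.\<close>
    have "and a X \<in> ?N" using a by (auto simp: bit_simps intro: ccontr)
    moreover have "?l (and a X) = a" "?r (and a X) = b"
      unfolding X [symmetric] D [symmetric] by (rule bit_eqI; auto simp: bit_simps)+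
    ultimately show "s \<in> (\<lambda>m. {?l m, ?r m}) ` ?N" using s by (intro image_eqI) auto
  qed
  ultimately have "card ?U = card ?N" by (metis (no_types, lifting) card_image)
  then show ?thesis
    by (simp only: card_submasks popcount_unset_bit [OF t])
qed

text \<open>Disjoint bits turn the sum of \<open>(S - X) / 2\<close> and \<open>X\<close> into their
  \<open>or\<close>. This sum is \<open>(S + X) / 2\<close>, hence nonnegative, and in two's
  complement an \<open>or\<close> is nonnegative only if both operands are.\<close>

lemma xor_le_sum_if_disjoint:
  fixes S X :: nat
  assumes "even (int S - int X)"
    and "\<And>i. \<not> (bit ((int S - int X) div 2) i \<and> bit X i)"
  shows "X \<le> S"
proof -
  let ?D = "(int S - int X) div 2"
  have "and ?D (int X) = 0"
    by (rule bit_eqI) (use assms(2) in \<open>auto simp: bit_simps\<close>)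
  then have "or ?D (int X) = ?D + int X" by (simp add: disjunctive_add_eq_or)
  also have "\<dots> \<ge> 0" by presburger
  finally show ?thesis by simp
qed

lemma sum_minus_xor_eq_double_and:
  fixes a b :: nat
  assumes "a + b = S" "xor a b = X"
  shows "int S - int X = 2 * int (and a b)"
  using add_eq_xor_plus_double_and [of a b] assms by simp

text \<open>For \<open>X = 0\<close> the entries coincide and no bit can select an order, so this
  case is computed directly.\<close>

lemma xor_pairs_zero: "xor_pairs S 0 = (if even S \<and> 0 < S then {{S div 2}} else {})"
proof -
  have "xor a b = 0 \<longleftrightarrow> a = b" for a b :: nat
    by (auto simp: bit_eq_iff bit_xor_iff)
  then show ?thesis by (auto simp: xor_pairs_def elim!: evenE)
qed

lemma image_Collect_diff:
  "{f a b | a b. f a b \<noteq> c \<and> P a b} = {f a b | a b. P a b} - {c}"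
  by blast

theorem theorem7p2:
  fixes S X :: nat
  shows "int (card (xor_pairs S X)) = pair_formula S X"
proof -
  let ?D = "(int S - int X) div 2"
  consider (empty) "odd (int S - int X) \<or> (\<exists>i. bit ?D i \<and> bit X i)"
    | (zero) "even (int S - int X)" "\<nexists>i. bit ?D i \<and> bit X i" "X = 0"
    | (pos) "even (int S - int X)" "\<nexists>i. bit ?D i \<and> bit X i" "X \<noteq> 0"
    by blast
  then show ?thesis
  proof cases
    case empty
    have "\<not> (a + b = S \<and> xor a b = X)" for a b :: nat
    proof
      assume ab: "a + b = S \<and> xor a b = X"
      then have *: "int S - int X = 2 * int (and a b)"
        using sum_minus_xor_eq_double_and by blast
      \<comment> \<open>By \<open>*\<close> the difference is even, leaving a common bit of
        \<open>and a b\<close> and \<open>xor a b\<close>, which cannot exist.\<close>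
      with empty obtain i where "bit (int (and a b)) i" "bit X i" by auto
      with ab show False by (auto simp: bit_simps)
    qed
    then have "xor_pairs S X = {}" by (auto simp: xor_pairs_def)
    with empty show ?thesis by (auto simp: pair_formula_def)
  next
    case zero
    \<comment> \<open>The exponent truncates to 0, so the formula gives 1 - 1 = 0 for
      \<open>S = 0\<close> and 1 for positive even \<open>S\<close>.\<close>
    then show ?thesis by (auto simp: xor_pairs_zero pair_formula_def popcount_0)
  next
    case pos
    have "X \<le> S" using xor_le_sum_if_disjoint pos by blast
    define D where "D = nat ?D"
    have D: "?D = int D" using \<open>X \<le> S\<close> by (simp add: D_def)
    have S: "S = X + 2 * D"
      using dvd_mult_div_cancel [OF pos(1)] unfolding D by linarith
    have disj: "\<not> (bit D i \<and> bit X i)" for i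
      using pos(2) unfolding D by (auto simp: bit_simps)
    let ?U = "{{a, b} | a b. xor a b = X \<and> and a b = D}"
    have U: "card ?U = 2 ^ (popcount X - 1)"
      using card_unordered_pairs_xor_and disj pos(3) by blast
    have iff: "a + b = S \<and> xor a b = X \<longleftrightarrow> xor a b = X \<and> and a b = D" for a b
      using add_eq_xor_plus_double_and [of a b] S by auto
    have eq: "xor_pairs S X = {{a, b} | a b. 0 < a \<and> 0 < b \<and> xor a b = X \<and> and a b = D}"
      unfolding xor_pairs_def using iff by blast
    show ?thesis
    proof (cases "D = 0")
      case True
      \<comment> \<open>If one entry is 0, the other is \<open>X\<close>. Positivity thus becomes a
        condition on the set \<open>{a, b}\<close> and removes a single element of
        \<open>?U\<close>.\<close>
      have nz: "0 < a \<and> 0 < b \<longleftrightarrow> {a, b} \<noteq> {0, X}" if "xor a b = X" for a b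
        using that by (cases "a = 0"; cases "b = 0") (auto simp: doubleton_eq_iff)
      have "xor_pairs S X = {{a, b} | a b. {a, b} \<noteq> {0, X} \<and> xor a b = X \<and> and a b = D}"
        unfolding eq by (intro Collect_cong ex_cong1) (metis nz)
      also have "\<dots> = ?U - {{0, X}}" by (rule image_Collect_diff)
      finally have "xor_pairs S X = ?U - {{0, X}}" .
      moreover have "{0, X} \<in> ?U" using True by force
      ultimately have "card (xor_pairs S X) = 2 ^ (popcount X - 1) - 1"
        using U by simp
      then show ?thesis using pos True S by (simp add: pair_formula_def of_nat_diff)
    next
      case False
      then have "0 < a \<and> 0 < b" if "and a b = D" for a b
        using that by (cases "a = 0"; cases "b = 0") auto
      then have "xor_pairs S X = ?U"
        unfolding eq by (intro Collect_cong ex_cong1) metis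
      then show ?thesis using U pos False S by (simp add: pair_formula_def)
    qed
  qed
qed

end
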